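(* Let $X$ be a real vector space, let $\Phi$ be a convex set of elementary functions $\varphi:X\to\mathbb{R}$ with $0\in\Phi$, and let $f,g:X\to(-\infty,+\infty]$ be proper functions with $\operatorname{dom} f\cap\operatorname{dom} g\neq\emptyset$. Let $\mathcal{L}(x,\varphi)=f(x)+\varphi(x)-g_\Phi^*(\varphi)$ be the $\Phi$-Lagrangian. Assume that $$\inf_{x\in X}\{f(x)+g(x)\}=\inf_{x\in X}\{f(x)+g_\Phi^{**}(x)\}.$$ Then the following are equivalent: (i) for every $\alpha\in\mathbb{R}$ with $\alpha<\inf_{x\in X}\sup_{\varphi\in\Phi}\mathcal{L}(x,\varphi)$ there exist $\varphi_1,\varphi_2\in\Phi$ and $\bar\varphi_1\in\operatorname{supp}_\Phi\mathcal{L}(\cdot,\varphi_1)$, $\bar\varphi_2\in\operatorname{supp}_\Phi\mathcal{L}(\cdot,\varphi_2)$ such that $\bar\varphi_1$ and $\bar\varphi_2$ have the intersection property on $X$ at the level $\alpha$; (ii) $$\inf_{x\in X}\{f(x)+g(x)\}=\sup_{\varphi\in\Phi}\bigl(-{}^*f_\Phi(\varphi)-g_\Phi^*(\varphi)\bigr),$$ where ${}^*f_\Phi(\varphi)=\sup_{x\in X}\{-\varphi(x)-f(x)\}$.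
   Context: A set of elementary functions $\Phi$ on $X$ is a set of real-valued functions $\varphi:X\to\mathbb{R}$ closed under addition of real constants. It is convex if it contains all convex combinations (taken pointwise) of its elements. A function $h:X\to(-\infty,+\infty]$ is proper if $\operatorname{dom} h=\{x: h(x)<+\infty\}\ne\emptyset$. $\Phi$-conjugate: $g_\Phi^*(\varphi)=\sup_{x\in X}(\varphi(x)-g(x))$ for $\varphi\in\Phi$. $\Phi$-biconjugate: $g_\Phi^{**}(x)=\sup_{\varphi\in\Phi}(\varphi(x)-g_\Phi^*(\varphi))$ for $x\in X$. For $h:X\to[-\infty,+\infty]$, $\operatorname{supp}_\Phi(h)=\{\varphi\in\Phi:\varphi(x)\le h(x)\ \forall x\in X\}$. $\mathcal{L}$ takes values in $[-\infty,+\infty]$; where an expression $(+\infty)+(-\infty)$ occurs (only at points $x$ with $f(x)=+\infty$) it may be read as $+\infty$. Intersection property: functions $\varphi_1,\varphi_2:X\to\mathbb{R}$ have the intersection property on $X$ at the level $\alpha\in\mathbb{R}$ if for every $t\in[0,1]$, either $[t\varphi_1+(1-t)\varphi_2<\alpha]\cap[\varphi_1<\alpha]=\emptyset$ or $[t\varphi_1+(1-t)\varphi_2<\alpha]\cap[\varphi_2<\alpha]=\emptyset$, where $[\varphi<\alpha]=\{x\in X:\varphi(x)<\alpha\}$. *)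

theory Defs
  imports "HOL-Analysis.Analysis"
begin

definition eff_domain :: "('a \<Rightarrow> ereal) \<Rightarrow> 'a set" where
  "eff_domain h = {x. h x < \<infinity>}"

(* Properness includes the codomain restriction h : X -> (-infinity, +infinity]. *)
definition proper_function :: "('a \<Rightarrow> ereal) \<Rightarrow> bool" where
  "proper_function h \<longleftrightarrow> (\<forall>x. h x \<noteq> -\<infinity>) \<and> eff_domain h \<noteq> {}"

definition elementary_functions :: "('a \<Rightarrow> real) set \<Rightarrow> bool" where
  "elementary_functions \<Phi> \<longleftrightarrow> (\<forall>\<phi>\<in>\<Phi>. \<forall>c::real. (\<lambda>x. \<phi> x + c) \<in> \<Phi>)"

(* The library's convex needs a real_vector instance, which the function type 'a => real
   does not have; this is closure under all finite pointwise convex combinations. *)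
definition convex_functions :: "('a \<Rightarrow> real) set \<Rightarrow> bool" where
  "convex_functions \<Phi> \<longleftrightarrow>
     (\<forall>S u. finite S \<and> S \<subseteq> \<Phi> \<and> (\<forall>\<phi>\<in>S. 0 \<le> u \<phi>) \<and> (\<Sum>\<phi>\<in>S. u \<phi>) = (1::real)
        \<longrightarrow> (\<lambda>x. \<Sum>\<phi>\<in>S. u \<phi> * \<phi> x) \<in> \<Phi>)"

definition conjugate :: "('a \<Rightarrow> ereal) \<Rightarrow> ('a \<Rightarrow> real) \<Rightarrow> ereal" where
  "conjugate g \<phi> = (SUP x. ereal (\<phi> x) - g x)"

definition biconjugate :: "('a \<Rightarrow> real) set \<Rightarrow> ('a \<Rightarrow> ereal) \<Rightarrow> 'a \<Rightarrow> ereal" where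
  "biconjugate \<Phi> g x = (SUP \<phi>\<in>\<Phi>. ereal (\<phi> x) - conjugate g \<phi>)"

definition left_conjugate :: "('a \<Rightarrow> ereal) \<Rightarrow> ('a \<Rightarrow> real) \<Rightarrow> ereal" where
  "left_conjugate f \<phi> = (SUP x. - ereal (\<phi> x) - f x)"

(* On ereal, (+infinity) + (-infinity) = (+infinity) - (+infinity) = +infinity. For proper f and g
   this case only occurs where f x = +infinity, and the Lagrangian is then +infinity. *)
definition lagrangian ::
    "('a \<Rightarrow> ereal) \<Rightarrow> ('a \<Rightarrow> ereal) \<Rightarrow> 'a \<Rightarrow> ('a \<Rightarrow> real) \<Rightarrow> ereal" where
  "lagrangian f g x \<phi> = f x + ereal (\<phi> x) - conjugate g \<phi>"

definition supp_functions :: "('a \<Rightarrow> real) set \<Rightarrow> ('a \<Rightarrow> ereal) \<Rightarrow> ('a \<Rightarrow> real) set" where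
  "supp_functions \<Phi> h = {\<phi>\<in>\<Phi>. \<forall>x. ereal (\<phi> x) \<le> h x}"

definition strict_sublevel :: "('a \<Rightarrow> real) \<Rightarrow> real \<Rightarrow> 'a set" where
  "strict_sublevel \<phi> \<alpha> = {x. \<phi> x < \<alpha>}"

definition intersection_property :: "('a \<Rightarrow> real) \<Rightarrow> ('a \<Rightarrow> real) \<Rightarrow> real \<Rightarrow> bool" where
  "intersection_property \<phi>1 \<phi>2 \<alpha> \<longleftrightarrow>
     (\<forall>t\<in>{0..1::real}.
        strict_sublevel (\<lambda>x. t * \<phi>1 x + (1 - t) * \<phi>2 x) \<alpha> \<inter> strict_sublevel \<phi>1 \<alpha> = {} \<or>
        strict_sublevel (\<lambda>x. t * \<phi>1 x + (1 - t) * \<phi>2 x) \<alpha> \<inter> strict_sublevel \<phi>2 \<alpha> = {})"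

end

theory Submission
  imports Defs
begin

text \<open>
  Since \<open>(SUP \<phi>\<in>\<Phi>. lagrangian f g x \<phi>) = f x + biconjugate \<Phi> g x\<close> and
  \<open>(INF x. lagrangian f g x \<phi>) = - left_conjugate f \<phi> - conjugate g \<phi>\<close>, the claim is
  that the minimax equality for the Lagrangian is equivalent to (i). If two functions have the
  intersection property at level \<open>\<alpha>\<close>, some convex combination of them is \<open>\<ge> \<alpha>\<close> everywhere:
  otherwise the parameters \<open>t\<close> whose sublevel set meets that of \<open>\<phi>1\<close>, and those whose sublevel set
  meets that of \<open>\<phi>2\<close>, would be a partition of \<open>[0,1]\<close> into two nonempty relatively open sets. By
  concavity of the Lagrangian in \<open>\<phi>\<close>, the dual value is then at least \<open>\<alpha>\<close>. Conversely, if the dual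
  value exceeds \<open>\<alpha>\<close>, the constant \<open>\<alpha>\<close> minorizes some \<open>lagrangian f g _ \<phi>\<close>.
\<close>

lemma elementary_functions_const:
  assumes "elementary_functions \<Phi>" "(\<lambda>x. 0) \<in> \<Phi>"
  shows "(\<lambda>x. c) \<in> \<Phi>"
  using assms unfolding elementary_functions_def by force

lemma convex_functions_combination:
  assumes \<Phi>: "convex_functions \<Phi>" and "\<phi>1 \<in> \<Phi>" "\<phi>2 \<in> \<Phi>" and t: "t \<in> {0..1::real}"
  shows "(\<lambda>x. t * \<phi>1 x + (1 - t) * \<phi>2 x) \<in> \<Phi>"
\<comment> \<open>The sum in \<open>convex_functions\<close> runs over a set, so for
  \<open>\<phi>1 = \<phi>2\<close> the set \<open>{\<phi>1, \<phi>2}\<close> would carry only one of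
  the two weights.\<close>
proof (cases "\<phi>1 = \<phi>2")
  case True
  then have "(\<lambda>x. t * \<phi>1 x + (1 - t) * \<phi>2 x) = \<phi>1"
    by (auto simp: algebra_simps)
  with assms show ?thesis by simp
next
  case False
  let ?u = "\<lambda>\<phi>. if \<phi> = \<phi>1 then t else 1 - t"
  have "(\<lambda>x. \<Sum>\<phi>\<in>{\<phi>1, \<phi>2}. ?u \<phi> * \<phi> x) \<in> \<Phi>"
    using assms False
    by (intro \<Phi>[unfolded convex_functions_def, rule_format]) auto
  with False show ?thesis by simp
qed

lemma intersection_property_imp_combination_ge:
  assumes ip: "intersection_property \<phi>1 \<phi>2 \<alpha>"
  shows "\<exists>t\<in>{0..1}. \<forall>x. \<alpha> \<le> t * \<phi>1 x + (1 - t) * \<phi>2 x"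
proof (rule ccontr)
  assume neg: "\<not> ?thesis"
  define S where "S t = strict_sublevel (\<lambda>x. t * \<phi>1 x + (1 - t) * \<phi>2 x) \<alpha>" for t
  \<comment> \<open>By \<open>A_iff\<close>, these are the parameters \<open>t\<close> for which
    \<open>S t\<close> meets \<open>S i\<close>. As a union over the points of \<open>S i\<close>
    the set is visibly open: each inequality is affine in \<open>t\<close>.\<close>
  define A where "A i = (\<Union>x\<in>S i. {t. t * \<phi>1 x + (1 - t) * \<phi>2 x < \<alpha>})" for i
  have S01: "S 1 = strict_sublevel \<phi>1 \<alpha>" "S 0 = strict_sublevel \<phi>2 \<alpha>"
    by (simp_all add: S_def)
  have A_iff: "t \<in> A i \<longleftrightarrow> S t \<inter> S i \<noteq> {}" for t i
    by (auto simp: A_def S_def strict_sublevel_def)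
  have "open (A i)" for i
    unfolding A_def by (intro open_UN ballI open_Collect_less continuous_intros)
  moreover have "S t \<noteq> {}" if "t \<in> {0..1}" for t
    using neg that by (force simp: S_def strict_sublevel_def not_le)
  \<comment> \<open>Where both functions are at least \<open>\<alpha>\<close>, so is their convex
    combination; the signs are flipped because \<open>convex_bound_le\<close> bounds from above. As
    \<open>S t\<close> is nonempty, each \<open>t\<close> then lies in \<open>A 1\<close> or
    \<open>A 0\<close>.\<close>
  moreover have "S t \<subseteq> S 1 \<union> S 0" if "t \<in> {0..1}" for t
  proof
    fix x assume "x \<in> S t"
    show "x \<in> S 1 \<union> S 0"
    proof (rule ccontr)
      assume "x \<notin> S 1 \<union> S 0"
      then have "\<alpha> \<le> t * \<phi>1 x + (1 - t) * \<phi>2 x"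
        using that convex_bound_le[of "- \<phi>1 x" "- \<alpha>" "- \<phi>2 x" t "1 - t"]
        by (simp add: S_def strict_sublevel_def)
      with \<open>x \<in> S t\<close> show False
        by (simp add: S_def strict_sublevel_def)
    qed
  qed
  ultimately have "{0..1} \<subseteq> A 1 \<union> A 0" "0 \<in> A 0" "1 \<in> A 1" "open (A 0)" "open (A 1)"
    using A_iff by fastforce+
  moreover have "A 1 \<inter> A 0 \<inter> {0..1} = {}"
    using ip unfolding intersection_property_def S01[symmetric] S_def[symmetric]
    by (auto simp: A_iff)
  moreover have "connected {0..1::real}" by simp
  ultimately show False
    unfolding connected_def by (metis IntI atLeastAtMost_iff empty_iff order_refl zero_le_one)
qed

lemma conjugate_ge: "ereal (\<phi> x) - g x \<le> conjugate g \<phi>"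
  unfolding conjugate_def by (rule SUP_upper) simp

lemma conjugate_neq_MInf:
  assumes "proper_function g"
  shows "conjugate g \<phi> \<noteq> -\<infinity>"
proof -
  obtain x where "g x \<noteq> \<infinity>"
    using assms by (auto simp: proper_function_def eff_domain_def)
  then show ?thesis
    using conjugate_ge[of \<phi> x g] by (cases "g x") auto
qed

text \<open>A supremum of functions affine in \<open>\<phi>\<close> is convex, and points with
  \<open>g x = \<infinity>\<close> only contribute \<open>-\<infinity>\<close>. This is the source
  of the concavity of the Lagrangian in \<open>\<phi>\<close>.\<close>

lemma conjugate_combination_le:
  assumes g: "proper_function g" and t: "t \<in> {0..1::real}"
    and c1: "conjugate g \<phi>1 = ereal c1" and c2: "conjugate g \<phi>2 = ereal c2"
  shows "conjugate g (\<lambda>x. t * \<phi>1 x + (1 - t) * \<phi>2 x) \<le> ereal (t * c1 + (1 - t) * c2)"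
  unfolding conjugate_def
proof (rule SUP_least)
  fix x
  show "ereal (t * \<phi>1 x + (1 - t) * \<phi>2 x) - g x \<le> ereal (t * c1 + (1 - t) * c2)"
  proof (cases "g x")
    case (real r)
    then have "\<phi>1 x - r \<le> c1" "\<phi>2 x - r \<le> c2"
      using conjugate_ge[of \<phi>1 x g] conjugate_ge[of \<phi>2 x g] c1 c2 by auto
    then have "t * (\<phi>1 x - r) + (1 - t) * (\<phi>2 x - r) \<le> t * c1 + (1 - t) * c2"
      using t by (intro add_mono mult_left_mono) auto
    with real show ?thesis by (simp add: algebra_simps)
  qed (use g in \<open>auto simp: proper_function_def\<close>)
qed

text \<open>The term \<open>f x\<close> is independent of \<open>\<phi>\<close> and never
  \<open>-\<infinity>\<close>, so it leaves the supremum over the nonempty \<open>\<Phi>\<close>.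
  Where \<open>f x = \<infinity>\<close>, the convention
  \<open>\<infinity> - \<infinity> = \<infinity>\<close> keeps the regrouping valid.\<close>

lemma SUP_lagrangian:
  assumes "proper_function f" "\<Phi> \<noteq> {}"
  shows "(SUP \<phi>\<in>\<Phi>. lagrangian f g x \<phi>) = f x + biconjugate \<Phi> g x"
proof -
  have f: "f x \<noteq> -\<infinity>"
    using assms by (simp add: proper_function_def)
  have "lagrangian f g x \<phi> = f x + (ereal (\<phi> x) - conjugate g \<phi>)" for \<phi>
    using f by (cases "f x"; cases "conjugate g \<phi>") (auto simp: lagrangian_def)
  then show ?thesis
    using f assms(2) by (simp add: biconjugate_def SUP_ereal_add_right)
qed

lemma INF_lagrangian:
  assumes f: "proper_function f" and g: "proper_function g"
  shows "(INF x. lagrangian f g x \<phi>) = - left_conjugate f \<phi> - conjugate g \<phi>"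
proof -
  have fx: "f x \<noteq> -\<infinity>" for x
    using f by (simp add: proper_function_def)
  obtain x0 where x0: "f x0 \<noteq> \<infinity>"
    using f by (auto simp: proper_function_def eff_domain_def)
  show ?thesis
  proof (cases "conjugate g \<phi>")
    case (real c)
    have "lagrangian f g x \<phi> = ereal (- c) - (- ereal (\<phi> x) - f x)" for x
      using fx[of x] real by (cases "f x") (auto simp: lagrangian_def)
    then have "(INF x. lagrangian f g x \<phi>) = ereal (- c) - left_conjugate f \<phi>"
      unfolding left_conjugate_def by (simp add: INF_ereal_minus_right)
    with real show ?thesis
      by (cases "left_conjugate f \<phi>") auto
  next
    case PInf
    have "(INF x. lagrangian f g x \<phi>) \<le> lagrangian f g x0 \<phi>"
      by (rule INF_lower) simp
    also have "\<dots> = -\<infinity>"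
      using x0 fx[of x0] PInf by (cases "f x0") (auto simp: lagrangian_def)
    finally have "(INF x. lagrangian f g x \<phi>) = -\<infinity>" by simp
    \<comment> \<open>The right side must not become
      \<open>\<infinity> - \<infinity> = \<infinity>\<close>, so
      \<open>- left_conjugate f \<phi>\<close> has to stay below \<open>\<infinity>\<close>.\<close>
    moreover have "- ereal (\<phi> x0) - f x0 \<le> left_conjugate f \<phi>"
      unfolding left_conjugate_def by (rule SUP_upper) simp
    then have "left_conjugate f \<phi> \<noteq> -\<infinity>"
      using x0 by (cases "f x0") auto
    ultimately show ?thesis
      using PInf by (cases "left_conjugate f \<phi>") auto
  next
    case MInf
    with conjugate_neq_MInf[OF g] show ?thesis by simp
  qed
qed

text \<open>A real-valued minorant keeps the Lagrangian above \<open>-\<infinity>\<close> where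
  \<open>f\<close> is finite, which rules out an infinite conjugate; properness of \<open>g\<close>
  rules out \<open>-\<infinity>\<close>.\<close>

lemma supp_lagrangian_conjugate_finite:
  assumes f: "proper_function f" and g: "proper_function g"
    and \<psi>: "\<psi> \<in> supp_functions \<Phi> (\<lambda>x. lagrangian f g x \<phi>)"
  obtains c where "conjugate g \<phi> = ereal c"
proof -
  obtain x0 where "f x0 \<noteq> \<infinity>" "f x0 \<noteq> -\<infinity>"
    using f by (auto simp: proper_function_def eff_domain_def)
  moreover have "ereal (\<psi> x0) \<le> lagrangian f g x0 \<phi>"
    using \<psi> by (simp add: supp_functions_def)
  ultimately have "conjugate g \<phi> \<noteq> \<infinity>"
    by (cases "f x0") (auto simp: lagrangian_def)
  with conjugate_neq_MInf[OF g, of \<phi>] show ?thesis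
    using that by (cases "conjugate g \<phi>") auto
qed

lemma intersection_property_imp_lagrangian_ge:
  assumes \<Phi>: "convex_functions \<Phi>" and f: "proper_function f" and g: "proper_function g"
    and \<phi>: "\<phi>1 \<in> \<Phi>" "\<phi>2 \<in> \<Phi>"
    and \<psi>1: "\<psi>1 \<in> supp_functions \<Phi> (\<lambda>x. lagrangian f g x \<phi>1)"
    and \<psi>2: "\<psi>2 \<in> supp_functions \<Phi> (\<lambda>x. lagrangian f g x \<phi>2)"
    and ip: "intersection_property \<psi>1 \<psi>2 \<alpha>"
  shows "\<exists>\<phi>\<in>\<Phi>. \<forall>x. ereal \<alpha> \<le> lagrangian f g x \<phi>"
proof -
  obtain t where t: "t \<in> {0..1}" and ge: "\<And>x. \<alpha> \<le> t * \<psi>1 x + (1 - t) * \<psi>2 x"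
    using intersection_property_imp_combination_ge[OF ip] by blast
  obtain c1 where c1: "conjugate g \<phi>1 = ereal c1"
    using supp_lagrangian_conjugate_finite[OF f g \<psi>1] .
  obtain c2 where c2: "conjugate g \<phi>2 = ereal c2"
    using supp_lagrangian_conjugate_finite[OF f g \<psi>2] .
  \<comment> \<open>The weight \<open>t\<close> that lifts the minorants above
    \<open>\<alpha>\<close> is reused for the multipliers, so that concavity transfers the bound to
    the Lagrangian at \<open>\<phi>\<close>.\<close>
  define \<phi> where "\<phi> = (\<lambda>x. t * \<phi>1 x + (1 - t) * \<phi>2 x)"
  have le: "conjugate g \<phi> \<le> ereal (t * c1 + (1 - t) * c2)"
    unfolding \<phi>_def by (rule conjugate_combination_le[OF g t c1 c2])
  have "ereal \<alpha> \<le> lagrangian f g x \<phi>" for x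
  proof (cases "f x")
    case (real r)
    then have "\<psi>1 x \<le> r + \<phi>1 x - c1" "\<psi>2 x \<le> r + \<phi>2 x - c2"
      using \<psi>1 \<psi>2 c1 c2 by (auto simp: supp_functions_def lagrangian_def dest!: spec[of _ x])
    then have "t * \<psi>1 x + (1 - t) * \<psi>2 x
        \<le> t * (r + \<phi>1 x - c1) + (1 - t) * (r + \<phi>2 x - c2)"
      using t by (intro add_mono mult_left_mono) auto
    also have "\<dots> = r + \<phi> x - (t * c1 + (1 - t) * c2)"
      by (simp add: \<phi>_def algebra_simps)
    finally have "ereal \<alpha> \<le> ereal (r + \<phi> x) - ereal (t * c1 + (1 - t) * c2)"
      using ge[of x] by simp
    also have "\<dots> \<le> ereal (r + \<phi> x) - conjugate g \<phi>"
      by (intro ereal_minus_mono order_refl le)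
    finally show ?thesis
      using real by (simp add: lagrangian_def)
  next
    case PInf
    then show ?thesis
      by (cases "conjugate g \<phi>") (auto simp: lagrangian_def)
  next
    case MInf
    with f show ?thesis by (simp add: proper_function_def)
  qed
  moreover have "\<phi> \<in> \<Phi>"
    unfolding \<phi>_def by (rule convex_functions_combination[OF \<Phi> \<phi> t])
  ultimately show ?thesis by blast
qed

theorem theorem6p4:
  fixes \<Phi> :: "('a::real_vector \<Rightarrow> real) set"
    and f g :: "'a \<Rightarrow> ereal"
  assumes "elementary_functions \<Phi>"
    and "convex_functions \<Phi>"
    and "(\<lambda>x. 0) \<in> \<Phi>"
    and "proper_function f"
    and "proper_function g"
    and "eff_domain f \<inter> eff_domain g \<noteq> {}"
    and "(INF x. f x + g x) = (INF x. f x + biconjugate \<Phi> g x)"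
  shows "(\<forall>\<alpha>::real. ereal \<alpha> < (INF x. SUP \<phi>\<in>\<Phi>. lagrangian f g x \<phi>) \<longrightarrow>
            (\<exists>\<phi>1\<in>\<Phi>. \<exists>\<phi>2\<in>\<Phi>.
              \<exists>\<psi>1\<in>supp_functions \<Phi> (\<lambda>x. lagrangian f g x \<phi>1).
              \<exists>\<psi>2\<in>supp_functions \<Phi> (\<lambda>x. lagrangian f g x \<phi>2).
                intersection_property \<psi>1 \<psi>2 \<alpha>))
         \<longleftrightarrow>
         (INF x. f x + g x) = (SUP \<phi>\<in>\<Phi>. - left_conjugate f \<phi> - conjugate g \<phi>)"
    (is "?i \<longleftrightarrow> _")
proof -
  let ?L = "lagrangian f g"
  let ?p = "INF x. SUP \<phi>\<in>\<Phi>. ?L x \<phi>" and ?d = "SUP \<phi>\<in>\<Phi>. INF x. ?L x \<phi>"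
  have primal: "(INF x. f x + g x) = ?p"
    using assms(3,4,7) by (subst SUP_lagrangian) auto
  have dual: "(SUP \<phi>\<in>\<Phi>. - left_conjugate f \<phi> - conjugate g \<phi>) = ?d"
    using assms(4,5) by (simp add: INF_lagrangian)
  have weak_duality: "?d \<le> ?p"
    by (intro SUP_least INF_greatest) (blast intro: order_trans INF_lower SUP_upper)
  have "?i \<longleftrightarrow> ?p = ?d"
  proof
    assume i: ?i
    have "?p \<le> ?d"
    proof (rule ccontr)
      assume "\<not> ?p \<le> ?d"
      \<comment> \<open>A real level inside the duality gap: (i) applies to it, yet it exceeds the
        dual value.\<close>
      then obtain \<alpha> :: real where \<alpha>: "?d < ereal \<alpha>" "ereal \<alpha> < ?p"
        using ereal_dense2 by (metis not_le)
      then obtain \<phi>1 \<phi>2 \<psi>1 \<psi>2 where "\<phi>1 \<in> \<Phi>" "\<phi>2 \<in> \<Phi>"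
          "\<psi>1 \<in> supp_functions \<Phi> (\<lambda>x. ?L x \<phi>1)" "\<psi>2 \<in> supp_functions \<Phi> (\<lambda>x. ?L x \<phi>2)"
          "intersection_property \<psi>1 \<psi>2 \<alpha>"
        using i by blast
      from intersection_property_imp_lagrangian_ge[OF assms(2,4,5) this]
      obtain \<phi> where "\<phi> \<in> \<Phi>" "\<And>x. ereal \<alpha> \<le> ?L x \<phi>" by blast
      then have "ereal \<alpha> \<le> ?d"
        by (intro SUP_upper2[of \<phi>] INF_greatest)
      with \<alpha> show False by simp
    qed
    with weak_duality show "?p = ?d" by (rule antisym[rotated])
  next
    assume eq: "?p = ?d"
    show ?i
    proof (intro allI impI)
      fix \<alpha> :: real
      assume "ereal \<alpha> < ?p"
      then obtain \<phi> where \<phi>: "\<phi> \<in> \<Phi>" and lt: "ereal \<alpha> < (INF x. ?L x \<phi>)"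
        unfolding eq by (auto simp: less_SUP_iff)
      have "ereal \<alpha> \<le> ?L x \<phi>" for x
        using lt by (meson INF_lower UNIV_I less_imp_le order_trans)
      \<comment> \<open>The constant \<open>\<alpha>\<close> serves as both minorants, with the same
        multiplier \<open>\<phi>\<close>. Its strict sublevel set at level \<open>\<alpha>\<close>
        is empty, so the intersection property is immediate.\<close>
      then have "(\<lambda>x. \<alpha>) \<in> supp_functions \<Phi> (\<lambda>x. ?L x \<phi>)"
        using elementary_functions_const[OF assms(1,3)] by (simp add: supp_functions_def)
      moreover have "intersection_property (\<lambda>x::'a. \<alpha>) (\<lambda>x. \<alpha>) \<alpha>"
        by (simp add: intersection_property_def strict_sublevel_def)
      ultimately show "\<exists>\<phi>1\<in>\<Phi>. \<exists>\<phi>2\<in>\<Phi>. \<exists>\<psi>1\<in>supp_functions \<Phi> (\<lambda>x. ?L x \<phi>1).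
          \<exists>\<psi>2\<in>supp_functions \<Phi> (\<lambda>x. ?L x \<phi>2). intersection_property \<psi>1 \<psi>2 \<alpha>"
        using \<phi> by blast
    qed
  qed
  then show ?thesis by (simp only: primal dual)
qed

end
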